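(* Let $0<p,q\le 1$ and let $f,g:[0,\infty)\to\mathbb{R}$ be piecewise continuous functions of exponential order, say $|f(u)|\le M e^{au}$ and $|g(v)|\le N e^{bv}$ for all $u,v>0$, with constants $M,N>0$ and $a,b\in\mathbb{R}$. Let $$h\left(\frac{x^p}{p},\frac{t^q}{q}\right)=f\left(\frac{x^p}{p}\right)g\left(\frac{t^q}{q}\right),\qquad x>0,\ t>0.$$ Then, for $r,s\in\mathbb{C}$ with $\operatorname{Re}(r)>a$ and $\operatorname{Re}(s)>b$, $$\mathcal{G}_x^p\mathcal{G}_t^q\left[h\left(\frac{x^p}{p},\frac{t^q}{q}\right)\right](r,s)=\mathcal{G}_x[f(x)](r)\;\mathcal{G}_t[g(t)](s).$$
   Context: Conformable double ARA transform (CDARAT): for $0<p,q\le1$ and a function $h(u,v)$ on $[0,\infty)\times[0,\infty)$, $$\mathcal{G}_x^p\mathcal{G}_t^q\left[h\left(\tfrac{x^p}{p},\tfrac{t^q}{q}\right)\right](r,s)=rs\int_0^\infty\int_0^\infty e^{-r\frac{x^p}{p}-s\frac{t^q}{q}}\,h\left(\tfrac{x^p}{p},\tfrac{t^q}{q}\right)x^{p-1}t^{q-1}\,dx\,dt .$$ The (ordinary, order one) ARA transform of a function of one variable is $\mathcal{G}_x[f(x)](r)=r\int_0^\infty e^{-rx}f(x)\,dx$, and similarly $\mathcal{G}_t[g(t)](s)=s\int_0^\infty e^{-st}g(t)\,dt$. *)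

theory Defs
  imports "HOL-Analysis.Analysis"
begin

text \<open>
  Functions on \<open>[0,\<infinity>)\<close> are represented by total functions on \<^typ>\<open>real\<close> whose values at
  negative arguments are never used.  Piecewise continuity has its usual meaning: finitely many
  discontinuities in each bounded interval, all of them with finite one-sided limits (only the
  right-hand limit is required at \<open>0\<close>).
\<close>

definition piecewise_continuous_halfline :: "(real \<Rightarrow> real) \<Rightarrow> bool" where
  "piecewise_continuous_halfline f \<longleftrightarrow>
     (\<forall>c\<ge>0. finite {x \<in> {0..c}. \<not> continuous (at x within {0..}) f}) \<and>
     (\<forall>x\<ge>0. \<exists>l. (f \<longlongrightarrow> l) (at_right x)) \<and>
     (\<forall>x>0. \<exists>l. (f \<longlongrightarrow> l) (at_left x))"

text \<open>
  Integrals from \<open>0\<close> to \<open>\<infinity>\<close> are Lebesgue integrals over the open half-line, which agrees with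
  \<open>[0,\<infinity>)\<close> up to a null set and avoids the convention \<open>0 powr (p - 1) = 0\<close>.  A Lebesgue
  integral of a non-integrable function is \<open>0\<close> by convention, so convergence of a transform is
  integrability of its integrand.
\<close>

definition ara_integrand :: "(real \<Rightarrow> real) \<Rightarrow> complex \<Rightarrow> real \<Rightarrow> complex" where
  "ara_integrand f r x = exp (- r * of_real x) * of_real (f x)"

definition ara :: "(real \<Rightarrow> real) \<Rightarrow> complex \<Rightarrow> complex" where
  "ara f r = r * (LINT x:{0<..}|lborel. ara_integrand f r x)"

definition cdara_integrand ::
  "real \<Rightarrow> real \<Rightarrow> (real \<Rightarrow> real \<Rightarrow> real) \<Rightarrow> complex \<Rightarrow> complex \<Rightarrow> real \<Rightarrow> real \<Rightarrow> complex" where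
  "cdara_integrand p q h r s x t =
     exp (- r * of_real (x powr p / p) - s * of_real (t powr q / q))
     * of_real (h (x powr p / p) (t powr q / q))
     * of_real (x powr (p - 1)) * of_real (t powr (q - 1))"

definition cdara ::
  "real \<Rightarrow> real \<Rightarrow> (real \<Rightarrow> real \<Rightarrow> real) \<Rightarrow> complex \<Rightarrow> complex \<Rightarrow> complex" where
  "cdara p q h r s =
     r * s * (LINT t:{0<..}|lborel. LINT x:{0<..}|lborel. cdara_integrand p q h r s x t)"

end

theory Submission
  imports Defs
begin

text \<open>
  The substitution \<open>u = x\<^sup>p / p\<close> has \<open>du = x\<^sup>p\<^sup>-\<^sup>1 dx\<close> and maps the open half-line bijectively onto
  itself, so the weight \<open>x\<^sup>p\<^sup>-\<^sup>1\<close> in the conformable transform is exactly the Jacobian that turns it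
  into an ordinary transform (\<open>powr_substitution\<close>).  When \<open>h\<close> is a product, the exponential splits
  as well, and the double integrand becomes \<open>F x * G t\<close>, where \<open>F\<close> and \<open>G\<close> are the substituted
  integrands of the two one-variable transforms.  The iterated integral of such a function
  factors by linearity alone; Fubini's theorem enters only for integrability on the quadrant
  (\<open>set_integrable_tensor\<close>).

  Convergence of the one-variable transforms comes from the exponential bounds
  (\<open>exponential_order_ara_integrable\<close>), with measurability supplied by piecewise continuity.
\<close>

text \<open>
  Finitely many discontinuities on each bounded interval make countably many in all, and
  a function that is continuous off a countable set is Borel.  Cutting off at \<open>0\<close> by the indicator
  adds at most one more discontinuity.
\<close>

lemma piecewise_continuous_halfline_borel_measurable:
  assumes "piecewise_continuous_halfline f"
  shows "(\<lambda>x. indicator {0<..} x *\<^sub>R f x) \<in> borel_measurable borel"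
proof -
  from assms
  have fin: "finite {x \<in> {0..c}. \<not> continuous (at x within {0..}) f}" if "c \<ge> 0" for c
    unfolding piecewise_continuous_halfline_def using that by (elim conjE) simp
  define D where "D = {x \<in> {0..}. \<not> continuous (at x within {0..}) f}"
  have "D \<subseteq> (\<Union>n::nat. {x \<in> {0..real n}. \<not> continuous (at x within {0..}) f})"
  proof
    fix x assume "x \<in> D"
    moreover obtain n :: nat where "x \<le> real n" using real_arch_simple by blast
    ultimately show "x \<in> (\<Union>n::nat. {x \<in> {0..real n}. \<not> continuous (at x within {0..}) f})"
      unfolding D_def by auto
  qed
  moreover have "countable \<dots>"
  proof (rule countable_UN)
    fix n :: nat
    show "countable {x \<in> {0..real n}. \<not> continuous (at x within {0..}) f}"
      by (rule countable_finite, rule fin) simp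
  qed simp
  ultimately have "countable D" by (rule countable_subset)
  have "isCont (\<lambda>x. indicator {0<..} x *\<^sub>R f x) x" if "x \<notin> insert 0 D" for x
  proof (cases "x > 0")
    case True
    with that have "continuous (at x within {0..}) f" by (auto simp: D_def)
    moreover have "at x within {0..} = at x"
      by (rule at_within_interior) (use True in simp)
    ultimately have "isCont f x" by simp
    moreover have "isCont (indicator {0<..} :: real \<Rightarrow> real) x"
      using True by (simp add: isCont_indicator frontier_def interior_open[OF open_greaterThan])
    ultimately show ?thesis by (intro continuous_scaleR)
  next
    case False
    with that have "x < 0" by auto
    then have "\<forall>\<^sub>F y in nhds x. y < 0"
      using eventually_nhds_in_open[of "{..<0}" x] by simp
    then have "\<forall>\<^sub>F y in nhds x. indicator {0<..} y *\<^sub>R f y = 0"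
      by (rule eventually_mono) simp
    then have "isCont (\<lambda>y. indicator {0<..} y *\<^sub>R f y) x \<longleftrightarrow> isCont (\<lambda>_. 0 :: real) x"
      by (rule isCont_cong)
    then show ?thesis by simp
  qed
  then have "continuous_on (- insert 0 D) (\<lambda>x. indicator {0<..} x *\<^sub>R f x)"
    by (intro continuous_at_imp_continuous_on) blast
  then show ?thesis
    by (rule borel_measurable_continuous_countable_exceptions[rotated]) (simp add: \<open>countable D\<close>)
qed

text \<open>
  The modulus of the integrand is at most \<open>M * exp (- (Re r - a) * x)\<close>, whose exponent decays.
\<close>

lemma exponential_order_ara_integrable:
  fixes f :: "real \<Rightarrow> real"
  assumes "(\<lambda>x. indicator {0<..} x *\<^sub>R f x) \<in> borel_measurable borel"
    and "\<And>u. u > 0 \<Longrightarrow> \<bar>f u\<bar> \<le> M * exp (a * u)"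
    and "Re r > a"
  shows "set_integrable lborel {0<..} (ara_integrand f r)"
proof (rule set_integrable_bound)
  have "((\<lambda>x. exp (- (Re r - a) * x)) integrable_on {0..})"
    using assms by (intro integrable_on_exp_minus_to_infinity) auto
  then have "(\<lambda>x. exp (- (Re r - a) * x)) absolutely_integrable_on {0..}"
    by (intro nonnegative_absolutely_integrable_1) auto
  then have "(\<lambda>x. exp (- (Re r - a) * x)) absolutely_integrable_on {0<..}"
    by (rule set_integrable_subset) auto
  then have "set_integrable lborel {0<..} (\<lambda>x. exp (- (Re r - a) * x))"
    unfolding set_integrable_def by (subst (asm) integrable_completion) auto
  then show "set_integrable lborel {0<..} (\<lambda>x. M * exp (- (Re r - a) * x))"
    by (rule set_integrable_mult_right)
  have "(\<lambda>x. exp (- r * of_real x) * of_real (indicator {0<..} x *\<^sub>R f x)) \<in> borel_measurable borel"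
  proof (rule borel_measurable_times)
    show "(\<lambda>x. exp (- r * complex_of_real x)) \<in> borel_measurable borel"
      by (intro borel_measurable_continuous_onI continuous_intros)
    show "(\<lambda>x. complex_of_real (indicator {0<..} x *\<^sub>R f x)) \<in> borel_measurable borel"
      by (rule measurable_compose[OF assms(1) borel_measurable_of_real])
  qed
  also have "(\<lambda>x. exp (- r * of_real x) * of_real (indicator {0<..} x *\<^sub>R f x))
    = (\<lambda>x. indicator {0<..} x *\<^sub>R ara_integrand f r x)"
    by (auto simp: fun_eq_iff ara_integrand_def indicator_def)
  finally show "set_borel_measurable lborel {0<..} (ara_integrand f r)"
    by (simp add: set_borel_measurable_def)
  have "norm (ara_integrand f r x) \<le> norm (M * exp (- (Re r - a) * x))" if "x > 0" for x
  proof -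
    have "norm (ara_integrand f r x) = exp (- Re r * x) * \<bar>f x\<bar>"
      by (simp add: ara_integrand_def norm_mult)
    also have "\<dots> \<le> exp (- Re r * x) * (M * exp (a * x))"
      using assms that by (intro mult_left_mono) auto
    also have "\<dots> = M * exp (- (Re r - a) * x)"
      by (simp add: exp_add[symmetric] algebra_simps flip: exp_add)
    finally show ?thesis by simp
  qed
  then show "AE x in lborel. x \<in> {0<..} \<longrightarrow>
      norm (ara_integrand f r x) \<le> norm (M * exp (- (Re r - a) * x))" by auto
qed

text \<open>
  The change-of-variables theorem gives Lebesgue integrability of the substituted function with
  respect to the completed measure; it descends to Borel measure because composing a Borel function
  with the power map is again Borel.
\<close>

lemma powr_substitution:
  fixes F :: "real \<Rightarrow> 'a::euclidean_space"
  assumes "0 < p" and F: "set_integrable lborel {0<..} F"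
  shows "set_integrable lborel {0<..} (\<lambda>x. x powr (p - 1) *\<^sub>R F (x powr p / p))"
    and "(LINT x:{0<..}|lborel. x powr (p - 1) *\<^sub>R F (x powr p / p)) = (LINT u:{0<..}|lborel. F u)"
proof -
  let ?g = "\<lambda>x::real. x powr p / p" and ?G = "\<lambda>x. x powr (p - 1) *\<^sub>R F (x powr p / p)"
  have img: "?g ` {0<..} = {0<..}"
  proof (intro equalityI subsetI)
    fix y :: real assume "y \<in> {0<..}"
    then have "y = ?g ((p * y) powr (1 / p))" "(p * y) powr (1 / p) \<in> {0<..}"
      using assms by (auto simp: powr_powr)
    then show "y \<in> ?g ` {0<..}" by blast
  qed (use assms in auto)
  have inj: "inj_on ?g {0<..}"
  proof (rule inj_onI)
    fix x y :: real assume "x \<in> {0<..}" "y \<in> {0<..}" "?g x = ?g y"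
    then show "x = y"
      using assms powr_less_mono2[of p x y] powr_less_mono2[of p y x]
      by (cases x y rule: linorder_cases) auto
  qed
  have der: "(?g has_field_derivative x powr (p - 1)) (at x within {0<..})" if "x \<in> {0<..}" for x
    using that assms by (auto intro!: derivative_eq_intros)
  have lebF: "F absolutely_integrable_on {0<..}"
    and intF: "integral {0<..} F = (LINT u:{0<..}|lborel. F u)"
    using set_borel_integral_eq_integral[OF F] F
    by (auto simp: set_integrable_def integrable_completion)
  have "(\<lambda>x. \<bar>x powr (p - 1)\<bar> *\<^sub>R F (?g x)) absolutely_integrable_on {0<..} \<and>
      integral {0<..} (\<lambda>x. \<bar>x powr (p - 1)\<bar> *\<^sub>R F (?g x)) = integral {0<..} F"
    using has_absolute_integral_change_of_variables_real[OF _ der inj, of F "integral {0<..} F"] lebF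
    unfolding img by simp
  then have leb: "?G absolutely_integrable_on {0<..}" and eq: "integral {0<..} ?G = integral {0<..} F"
    by auto
  have "(\<lambda>x. indicator {0<..} x *\<^sub>R F x) \<in> borel_measurable borel"
    using F by (auto simp: set_integrable_def)
  from measurable_compose[OF _ this, of ?g borel]
  have "(\<lambda>x. (indicator {0<..} x * x powr (p - 1)) *\<^sub>R (indicator {0<..} (?g x) *\<^sub>R F (?g x)))
     \<in> borel_measurable borel" by measurable
  also have "(\<lambda>x. (indicator {0<..} x * x powr (p - 1)) *\<^sub>R (indicator {0<..} (?g x) *\<^sub>R F (?g x)))
     = (\<lambda>x. indicator {0<..} x *\<^sub>R ?G x)"
    using assms by (auto simp: indicator_def fun_eq_iff)
  finally show *: "set_integrable lborel {0<..} ?G"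
    using leb unfolding set_integrable_def by (subst (asm) integrable_completion) auto
  show "(LINT x:{0<..}|lborel. ?G x) = (LINT u:{0<..}|lborel. F u)"
    using set_borel_integral_eq_integral(2)[OF *] eq intF by simp
qed

text \<open>
  By Fubini's theorem, as the iterated integral of \<open>\<bar>F x * G y\<bar>\<close> is the product of the two
  \<open>L\<^sup>1\<close> norms.
\<close>

lemma set_integrable_tensor:
  fixes F G :: "real \<Rightarrow> complex"
  assumes F: "set_integrable lborel A F" and G: "set_integrable lborel B G"
  shows "set_integrable lborel (A \<times> B) (\<lambda>(x, y). F x * G y)"
proof -
  let ?F = "\<lambda>x. indicator A x *\<^sub>R F x" and ?G = "\<lambda>x. indicator B x *\<^sub>R G x"
  have [measurable]: "?F \<in> borel_measurable borel" "?G \<in> borel_measurable borel"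
    using F G by (auto simp: set_integrable_def)
  have "integrable (lborel \<Otimes>\<^sub>M lborel) (\<lambda>z. ?F (fst z) * ?G (snd z))"
  proof (rule lborel_pair.Fubini_integrable)
    have "integrable lborel (\<lambda>x. norm (?F x) * (\<integral>y. norm (?G y) \<partial>lborel))"
      using F by (intro integrable_mult_left integrable_norm) (simp add: set_integrable_def)
    then show "integrable lborel (\<lambda>x. \<integral>y. norm (?F (fst (x, y)) * ?G (snd (x, y))) \<partial>lborel)"
      by (simp only: norm_mult fst_conv snd_conv integral_mult_right_zero)
    show "AE x in lborel. integrable lborel (\<lambda>y. ?F (fst (x, y)) * ?G (snd (x, y)))"
      unfolding fst_conv snd_conv using G
      by (intro AE_I2 integrable_mult_right) (simp add: set_integrable_def)
  qed measurable
  then show ?thesis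
    unfolding set_integrable_def lborel_prod
    by (rule back_subst[of "integrable lborel"]) (auto simp: fun_eq_iff indicator_def)
qed

theorem mainTheorem1:
  fixes p q a b M N :: real
    and f g :: "real \<Rightarrow> real"
    and h :: "real \<Rightarrow> real \<Rightarrow> real"
    and r s :: complex
  assumes "0 < p" "p \<le> 1" "0 < q" "q \<le> 1"
    and "piecewise_continuous_halfline f" "piecewise_continuous_halfline g"
    and "M > 0" "N > 0"
    and "\<And>u. u > 0 \<Longrightarrow> \<bar>f u\<bar> \<le> M * exp (a * u)"
    and "\<And>v. v > 0 \<Longrightarrow> \<bar>g v\<bar> \<le> N * exp (b * v)"
    and "\<And>x t. x > 0 \<Longrightarrow> t > 0 \<Longrightarrow>
           h (x powr p / p) (t powr q / q) = f (x powr p / p) * g (t powr q / q)"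
    and "Re r > a" "Re s > b"
  shows "set_integrable lborel {0<..} (ara_integrand f r)
       \<and> set_integrable lborel {0<..} (ara_integrand g s)
       \<and> set_integrable lborel ({0<..} \<times> {0<..}) (\<lambda>(x, t). cdara_integrand p q h r s x t)
       \<and> cdara p q h r s = ara f r * ara g s"
proof -
  have f: "set_integrable lborel {0<..} (ara_integrand f r)"
    and g: "set_integrable lborel {0<..} (ara_integrand g s)"
    using exponential_order_ara_integrable[of f M a r] exponential_order_ara_integrable[of g N b s]
      piecewise_continuous_halfline_borel_measurable assms(5,6,9,10,12,13) by blast+
  define F where "F x = x powr (p - 1) *\<^sub>R ara_integrand f r (x powr p / p)" for x
  define G where "G t = t powr (q - 1) *\<^sub>R ara_integrand g s (t powr q / q)" for t
  note F = powr_substitution[OF \<open>0 < p\<close> f, folded F_def]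
  note G = powr_substitution[OF \<open>0 < q\<close> g, folded G_def]
  have split: "cdara_integrand p q h r s x t = F x * G t" if "x > 0" "t > 0" for x t
  proof -
    have "exp (- r * of_real (x powr p / p) - s * of_real (t powr q / q))
        = exp (- r * of_real (x powr p / p)) * exp (- s * of_real (t powr q / q))"
      by (simp flip: exp_add)
    then show ?thesis
      unfolding cdara_integrand_def F_def G_def ara_integrand_def assms(11)[OF that]
        scaleR_conv_of_real of_real_mult by (simp only: mult_ac)
  qed
  have prod: "set_integrable lborel ({0<..} \<times> {0<..}) (\<lambda>(x, t). cdara_integrand p q h r s x t)
      \<longleftrightarrow> set_integrable lborel ({0<..} \<times> {0<..}) (\<lambda>(x, t). F x * G t)"
    by (intro set_integrable_cong refl) (auto simp: split)
  have inner: "(LINT x:{0<..}|lborel. cdara_integrand p q h r s x t)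
      = (LINT x:{0<..}|lborel. F x) * G t" if "t > 0" for t
  proof -
    have "(LINT x:{0<..}|lborel. cdara_integrand p q h r s x t) = (LINT x:{0<..}|lborel. F x * G t)"
      using that by (intro set_lebesgue_integral_cong) (auto simp: split)
    then show ?thesis by simp
  qed
  have "(LINT t:{0<..}|lborel. LINT x:{0<..}|lborel. cdara_integrand p q h r s x t)
      = (LINT t:{0<..}|lborel. (LINT x:{0<..}|lborel. F x) * G t)"
    by (intro set_lebesgue_integral_cong) (auto simp: inner)
  also have "\<dots> = (LINT x:{0<..}|lborel. F x) * (LINT t:{0<..}|lborel. G t)"
    by simp
  finally have "cdara p q h r s = ara f r * ara g s"
    by (simp add: cdara_def ara_def F G mult_ac)
  then show ?thesis
    using f g prod set_integrable_tensor[OF F(1) G(1)] by blast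
qed

end
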